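(* Let $\alpha_k=0$ if $k=3r-1$, $\alpha_k=\frac{1-q^{6r+2}}{1-q^2}q^{6r^2+r}$ if $k=3r$, $\alpha_k=-\frac{1-q^{6r+4}}{1-q^2}q^{6r^2+5r+1}$ if $k=3r+1$. Then for every integer $p\ge1$, every positive integer $N$ and every primitive $N$th root of unity $q$, $$H_p^{(9)}(q)=q^{p}\sum_{k=0}^{N-1}(-1)^kq^{-\binom{k+1}{2}}\bigl(q^{p(k^2+2k)}\alpha_k\bigr)^*.$$
   Context: $(a)_n=\prod_{k=1}^n(1-aq^{k-1})$, $\begin{bmatrix} n\\ k\end{bmatrix}=\frac{(q)_n}{(q)_{n-k}(q)_k}$. $H_p^{(9)}(q)=\sum_{n_p\ge\cdots\ge n_1\ge0}q^{-n_p^2-n_p}(q^{n_p+1})_{n_p}\prod_{i=1}^{p-1}q^{n_i^2}\begin{bmatrix} n_{i+1}\\ n_i\end{bmatrix}$; at a root of unity only finitely many terms are nonzero. For $a_k=q^{p(k^2+2k)}\alpha_k$, $a_k^*:=(1-q^2)\left(\frac{a_k}{1-q^{2k+2}}-\frac{q^{2k}a_{k-1}}{1-q^{2k}}\right)$ with $a_{-1}=0$; the quotients are simplified as rational functions in $q$ before evaluating, so that $(1-q^2)\alpha_k/(1-q^{2k+2})$ equals $q^{6r^2+r}$ for $k=3r$, $-q^{6r^2+5r+1}$ for $k=3r+1$, and $0$ for $k=3r-1$. *)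

theory Defs
  imports
    "HOL-Analysis.Analysis"
    "HOL-Computational_Algebra.Computational_Algebra"
    "HOL-Computational_Algebra.Field_as_Ring"
begin

definition primitive_unity_root :: "nat \<Rightarrow> complex \<Rightarrow> bool" where
  "primitive_unity_root N q \<longleftrightarrow> q ^ N = 1 \<and> (\<forall>m. 0 < m \<and> m < N \<longrightarrow> q ^ m \<noteq> 1)"

text \<open>The rational functions in \<open>q\<close> are the elements of \<open>complex poly fract\<close>, with \<open>qvar\<close> as the
  indeterminate \<open>q\<close>. The value of a rational function at a point is the quotient of the values
  of the numerator and the denominator in lowest terms.\<close>

definition qvar :: "complex poly fract" where
  "qvar = to_fract [:0, 1:]"

definition eval_ratfun :: "complex poly fract \<Rightarrow> complex \<Rightarrow> complex" where
  "eval_ratfun f x = poly (fst (quot_of_fract f)) x / poly (snd (quot_of_fract f)) x"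

definition qpoch :: "'a::comm_ring_1 \<Rightarrow> 'a \<Rightarrow> nat \<Rightarrow> 'a" where
  "qpoch a q n = (\<Prod>k=1..n. 1 - a * q ^ (k - 1))"

text \<open>Only meant for \<open>k \<le> n\<close>.\<close>

definition qbinom :: "'a::field \<Rightarrow> nat \<Rightarrow> nat \<Rightarrow> 'a" where
  "qbinom q n k = qpoch q q n / (qpoch q q (n - k) * qpoch q q k)"

text \<open>The summation range of \<open>H9\<close>: tuples \<open>(n 1, \<dots>, n p)\<close> with \<open>n 1 \<le> \<dots> \<le> n p\<close>. Its summand
  vanishes at a root of unity for all but finitely many tuples, since \<open>(q\<^bsup>m+1\<^esup>)\<^sub>m\<close> does for
  large \<open>m\<close>; so the infinite sum is a finite one. The binomial is evaluated
  as a rational function because its numerator and denominator may both vanish at the point.\<close>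

definition mono_tuples :: "nat \<Rightarrow> (nat \<Rightarrow> nat) set" where
  "mono_tuples p = {n \<in> {1..p} \<rightarrow>\<^sub>E UNIV. \<forall>i\<in>{1..<p}. n i \<le> n (i + 1)}"

definition H9 :: "nat \<Rightarrow> complex \<Rightarrow> complex" where
  "H9 p q = (\<Sum>\<^sub>\<infinity>n\<in>mono_tuples p.
     q powi (- int ((n p)\<^sup>2) - int (n p)) * qpoch (q ^ (n p + 1)) q (n p) *
     (\<Prod>i\<in>{1..<p}. q ^ ((n i)\<^sup>2) * eval_ratfun (qbinom qvar (n (i + 1)) (n i)) q))"

definition alpha :: "'a::field \<Rightarrow> nat \<Rightarrow> 'a" where
  "alpha q k = (let r = k div 3 in
     if k mod 3 = 0 then (1 - q ^ (6 * r + 2)) / (1 - q ^ 2) * q ^ (6 * r\<^sup>2 + r)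
     else if k mod 3 = 1 then - ((1 - q ^ (6 * r + 4)) / (1 - q ^ 2)) * q ^ (6 * r\<^sup>2 + 5 * r + 1)
     else 0)"

text \<open>The operation \<open>a\<^sub>k \<mapsto> a\<^sub>k\<^sup>*\<close>, with \<open>a\<^bsub>-1\<^esub> = 0\<close>; so the second quotient
  is absent for \<open>k = 0\<close>.\<close>

definition star :: "'a::field \<Rightarrow> (nat \<Rightarrow> 'a) \<Rightarrow> nat \<Rightarrow> 'a" where
  "star q a k = (1 - q ^ 2) *
     (a k / (1 - q ^ (2 * k + 2)) -
      (if k = 0 then 0 else q ^ (2 * k) * a (k - 1) / (1 - q ^ (2 * k))))"

end

theory Submission
  imports Defs
begin

text \<open>For generic \<open>x\<close>, Slater's finite form of the pentagonal number theorem makes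
  \<open>\<beta>\<^sub>n = 1 / (x\<^sup>2)\<^bsub>2n\<^esub>\<close> the partner of \<open>\<alpha>\<^sub>k\<close> in a Bailey pair relative to \<open>x\<^sup>2\<close>. Applying the Bailey
  chain \<open>p\<close> times inserts the factor \<open>x\<^bsup>p(k\<^sup>2+2k)\<^esup>\<close>, and the star operation passes to a Bailey
  pair relative to \<open>x\<close> with the same \<open>\<beta>\<close>. Now multiply \<open>\<beta>\<^bsub>N-1\<^esub>\<close> by \<open>(x)\<^bsub>N-1\<^esub>(x)\<^sub>N / (1 - x)\<close> and let \<open>x\<close> tend
  to \<open>q\<close>. The \<open>k\<close>-th coefficient on the \<open>\<alpha>\<close>-side tends to \<open>(-1)\<^sup>k q\<^bsup>-k(k+1)/2\<^esup>\<close>. On the \<open>\<beta>\<close>-side the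
  substitution \<open>n\<^sub>i = N - 1 - m\<^sub>i\<close> turns \<open>q\<^bsup>n\<^sup>2+2n\<^esup>\<close> into \<open>q\<^bsup>m\<^sup>2-1\<^esup>\<close>, whence the factor \<open>q\<^bsup>-p\<^esup>\<close>, and the
  remaining multisum is \<open>H\<^sub>p\<close>.\<close>

lemma sum_triangle_swap:
  fixes n :: nat
  shows "(\<Sum>j\<le>n. \<Sum>k\<le>j. f j k) = (\<Sum>k\<le>n. \<Sum>j=k..n. f j k)"
proof -
  have "(\<Sum>j\<le>n. \<Sum>k\<le>j. f j k) = (\<Sum>(j, k)\<in>(SIGMA j:{..n}. {..j}). f j k)"
    by (rule sum.Sigma) auto
  also have "\<dots> = (\<Sum>(k, j)\<in>(SIGMA k:{..n}. {k..n}). f j k)"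
    by (rule sum.reindex_bij_witness[of _ "\<lambda>(k, j). (j, k)" "\<lambda>(j, k). (k, j)"]) auto
  also have "\<dots> = (\<Sum>k\<le>n. \<Sum>j=k..n. f j k)"
    by (rule sum.Sigma[symmetric]) auto
  finally show ?thesis .
qed

section \<open>Gaussian polynomials\<close>

lemma qpoch_0 [simp]: "qpoch a q 0 = 1"
  by (simp add: qpoch_def)

lemma qpoch_Suc: "qpoch a q (Suc n) = qpoch a q n * (1 - a * q ^ n)"
  by (simp add: qpoch_def)

lemma qpoch_add: "qpoch a q (m + n) = qpoch a q m * qpoch (a * q ^ m) q n"
  by (induction n) (simp_all add: qpoch_Suc power_add mult_ac)

lemma qpoch_eq_0:
  assumes "i < n" "a * q ^ i = 1"
  shows "qpoch a q n = 0"
proof -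
  have "Suc i \<in> {1..n}" "1 - a * q ^ (Suc i - 1) = 0"
    using assms by auto
  then show ?thesis
    unfolding qpoch_def by (intro prod_zero bexI[of _ "Suc i"]) auto
qed

lemma qpoch_nonzero:
  fixes q :: "'a::idom"
  assumes "\<And>j. 0 < j \<Longrightarrow> j \<le> n \<Longrightarrow> q ^ j \<noteq> 1"
  shows "qpoch q q n \<noteq> 0"
proof -
  have "q * q ^ (k - 1) \<noteq> 1" if "k \<in> {1..n}" for k
    using assms[of k] that by (cases k) auto
  then show ?thesis
    unfolding qpoch_def by (auto simp: eq_commute[of 1])
qed

lemma tendsto_qpoch [tendsto_intros]:
  fixes f g :: "'b \<Rightarrow> 'a::{comm_ring_1,real_normed_algebra_1}"
  assumes "(f \<longlongrightarrow> a) F" "(g \<longlongrightarrow> b) F"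
  shows "((\<lambda>x. qpoch (f x) (g x) n) \<longlongrightarrow> qpoch a b n) F"
  by (induction n) (auto simp: qpoch_Suc intro!: tendsto_intros assms)

text \<open>Gaussian binomials by Pascal's rule: without division they make sense, and are
  continuous in the base, at roots of unity, where the quotient of q-factorials may be 0/0.\<close>

fun gbin :: "'a::comm_ring_1 \<Rightarrow> nat \<Rightarrow> nat \<Rightarrow> 'a" where
  "gbin q n 0 = 1"
| "gbin q 0 (Suc k) = 0"
| "gbin q (Suc n) (Suc k) = q ^ Suc k * gbin q n (Suc k) + gbin q n k"

lemma gbin_eq_0: "n < k \<Longrightarrow> gbin q n k = 0"
  by (induction q n k rule: gbin.induct) auto

lemma gbin_self [simp]: "gbin q n n = 1"
  by (induction n) (auto simp: gbin_eq_0)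

text \<open>Multiplied by the q-factorials, Pascal's rule becomes
  \<open>q^(k+1) (1 - q^(n-k)) + (1 - q^(k+1)) = 1 - q^(n+1)\<close>.\<close>

lemma gbin_mult_qpoch:
  "k \<le> n \<Longrightarrow> gbin q n k * (qpoch q q (n - k) * qpoch q q k) = qpoch q q n"
proof (induction q n k rule: gbin.induct)
  case (3 q n k)
  show ?case
  proof (cases "k = n")
    case False
    with 3 have "k < n" by simp
    then obtain d where d: "n = k + Suc d"
      using less_imp_Suc_add by auto
    have 1: "gbin q n (Suc k) * (qpoch q q d * qpoch q q (Suc k)) = qpoch q q n"
      using 3 d by simp
    have 2: "gbin q n k * (qpoch q q (Suc d) * qpoch q q k) = qpoch q q n"
      using 3 d by simp
    have "gbin q (Suc n) (Suc k) * (qpoch q q (Suc n - Suc k) * qpoch q q (Suc k))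
        = q ^ Suc k * (1 - q ^ Suc d) * (gbin q n (Suc k) * (qpoch q q d * qpoch q q (Suc k)))
          + (1 - q ^ Suc k) * (gbin q n k * (qpoch q q (Suc d) * qpoch q q k))"
      by (simp add: d qpoch_Suc algebra_simps)
    also have "\<dots> = qpoch q q (Suc n)"
      unfolding 1 2 by (simp add: d qpoch_Suc algebra_simps power_add)
    finally show ?thesis .
  qed simp
qed auto

lemma tendsto_gbin [tendsto_intros]:
  fixes f :: "'b \<Rightarrow> 'a::{comm_ring_1,real_normed_algebra_1}"
  assumes "(f \<longlongrightarrow> a) F"
  shows "((\<lambda>x. gbin (f x) n k) \<longlongrightarrow> gbin a n k) F"
proof (induction n arbitrary: k)
  case 0
  show ?case by (cases k) auto
next
  case (Suc n)
  show ?case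
    by (cases k) (auto intro!: tendsto_intros assms Suc simp del: power_Suc)
qed

lemma poly_gbin: "poly (gbin p n k) x = gbin (poly p x) n k"
  by (induction p n k rule: gbin.induct) (auto simp: poly_power)

lemma to_fract_gbin: "to_fract (gbin p n k) = gbin (to_fract p) n k"
proof (induction p n k rule: gbin.induct)
  case (3 q n k)
  have "to_fract (q ^ m) = to_fract q ^ m" for m
    by (induction m) simp_all
  with 3 show ?case by (simp del: power_Suc)
qed auto

text \<open>Bases whose q-factorials are invertible. Instances are the indeterminate
  \<open>qvar\<close>, where quotients are simplified, and the points of the unit disc from which
  the limit at \<open>q\<close> is taken.\<close>

locale generic_base =
  fixes x :: "'a::field"
  assumes nonzero: "x \<noteq> 0" and power_neq_1: "\<And>j. 0 < j \<Longrightarrow> x ^ j \<noteq> 1"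
begin

lemma qpoch_neq_0 [simp]: "qpoch x x n \<noteq> 0"
  by (rule qpoch_nonzero) (use power_neq_1 in auto)

lemma gbin_eq_qpoch: "k \<le> n \<Longrightarrow> gbin x n k = qpoch x x n / (qpoch x x (n - k) * qpoch x x k)"
  using gbin_mult_qpoch[of k n x] by (simp add: field_simps)

lemma gbin_symmetric: "k \<le> n \<Longrightarrow> gbin x n (n - k) = gbin x n k"
  by (simp add: gbin_eq_qpoch mult.commute)

lemma gbin_Suc_Suc':
  assumes "k \<le> n"
  shows "gbin x (Suc n) (Suc k) = gbin x n (Suc k) + x ^ (n - k) * gbin x n k"
proof (cases "k = n")
  case False
  then obtain d where d: "n = k + Suc d"
    using assms less_imp_Suc_add[of k n] by auto
  have "gbin x (Suc n) (Suc k) = gbin x (Suc n) (Suc d)"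
    using gbin_symmetric[of "Suc d" "Suc n"] d by simp
  also have "\<dots> = x ^ Suc d * gbin x n (Suc d) + gbin x n d"
    by simp
  also have "gbin x n (Suc d) = gbin x n k"
    using gbin_symmetric[of k n] d by simp
  also have "gbin x n d = gbin x n (Suc k)"
    using gbin_symmetric[of d n] d by simp
  finally show ?thesis
    using d by simp
qed (simp add: gbin_eq_0)

end

section \<open>Rational functions and their values\<close>

lemma generic_base_qvar: "generic_base qvar"
proof
  show "qvar \<noteq> 0"
    by (simp add: qvar_def)
  fix j :: nat assume "0 < j"
  have pow: "qvar ^ j = to_fract (monom 1 j)"
    by (induction j) (simp_all add: qvar_def monom_Suc flip: to_fract_mult)
  have "monom 1 j \<noteq> (1 :: complex poly)"
    using \<open>0 < j\<close> degree_monom_eq[of "1::complex" j] by auto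
  then show "qvar ^ j \<noteq> 1"
    by (simp add: pow flip: to_fract_1)
qed

lemma eval_ratfun_to_fract: "eval_ratfun (to_fract f) x = poly f x"
  by (simp add: eval_ratfun_def)

text \<open>In the function field the quotient is a polynomial, so its lowest terms have denominator
  1 and evaluation is substitution.\<close>

lemma eval_ratfun_qbinom:
  assumes "k \<le> n"
  shows "eval_ratfun (qbinom qvar n k) x = gbin x n k"
proof -
  have "qbinom qvar n k = gbin qvar n k"
    using generic_base.gbin_eq_qpoch[OF generic_base_qvar assms] by (simp add: qbinom_def)
  also have "\<dots> = to_fract (gbin [:0, 1:] n k)"
    by (simp add: to_fract_gbin qvar_def)
  finally show ?thesis
    by (simp add: eval_ratfun_to_fract poly_gbin)
qed

section \<open>The Bailey pair\<close>

text \<open>This is \<open>(1 - q^2) alpha_k / (1 - q^(2k+2))\<close> after cancellation, hence a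
  polynomial in \<open>q\<close>.\<close>

definition acoef :: "'a::comm_ring_1 \<Rightarrow> nat \<Rightarrow> 'a" where
  "acoef q k = (let r = k div 3 in
     if k mod 3 = 0 then q ^ (6 * r\<^sup>2 + r)
     else if k mod 3 = 1 then - (q ^ (6 * r\<^sup>2 + 5 * r + 1))
     else 0)"

lemma acoef_3:
  "acoef q (3 * r) = q ^ (6 * r\<^sup>2 + r)"
  "acoef q (Suc (3 * r)) = - (q ^ (6 * r\<^sup>2 + 5 * r + 1))"
  "acoef q (Suc (Suc (3 * r))) = 0"
proof -
  have "Suc (3 * r) div 3 = r" "Suc (3 * r) mod 3 = 1" "Suc (Suc (3 * r)) mod 3 = 2"
    by presburger+
  then show "acoef q (3 * r) = q ^ (6 * r\<^sup>2 + r)"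
    "acoef q (Suc (3 * r)) = - (q ^ (6 * r\<^sup>2 + 5 * r + 1))"
    "acoef q (Suc (Suc (3 * r))) = 0"
    by (simp_all add: acoef_def)
qed

lemma alpha_3:
  "alpha q (3 * r) = (1 - q ^ (6 * r + 2)) / (1 - q ^ 2) * q ^ (6 * r\<^sup>2 + r)"
  "alpha q (Suc (3 * r)) = - ((1 - q ^ (6 * r + 4)) / (1 - q ^ 2)) * q ^ (6 * r\<^sup>2 + 5 * r + 1)"
  "alpha q (Suc (Suc (3 * r))) = 0"
proof -
  have m: "Suc (3 * r) div 3 = r" "Suc (3 * r) mod 3 = 1" "Suc (Suc (3 * r)) mod 3 = 2"
    by presburger+
  show "alpha q (3 * r) = (1 - q ^ (6 * r + 2)) / (1 - q ^ 2) * q ^ (6 * r\<^sup>2 + r)"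
    "alpha q (Suc (3 * r)) = - ((1 - q ^ (6 * r + 4)) / (1 - q ^ 2)) * q ^ (6 * r\<^sup>2 + 5 * r + 1)"
    "alpha q (Suc (Suc (3 * r))) = 0"
    unfolding alpha_def m Let_def by simp_all
qed

lemma tendsto_acoef [tendsto_intros]:
  fixes f :: "'b \<Rightarrow> 'a::{comm_ring_1,real_normed_algebra_1}"
  assumes "(f \<longlongrightarrow> a) F"
  shows "((\<lambda>x. acoef (f x) k) \<longlongrightarrow> acoef a k) F"
  unfolding acoef_def Let_def by (auto intro!: tendsto_intros assms)

text \<open>With value 0 outside \<open>0..n\<close>, both Pascal rules and the reflection hold for
  every integer index, as bilateral sums require.\<close>

definition gbin_int :: "'a::comm_ring_1 \<Rightarrow> nat \<Rightarrow> int \<Rightarrow> 'a" where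
  "gbin_int q n k = (if k < 0 then 0 else gbin q n (nat k))"

lemma gbin_int_eq_0: "k < 0 \<or> int n < k \<Longrightarrow> gbin_int q n k = 0"
  by (auto simp: gbin_int_def gbin_eq_0)

section \<open>The finite pentagonal number theorem\<close>

context generic_base
begin

lemma gbin_int_symmetric: "gbin_int x n (int n - k) = gbin_int x n k"
proof (cases "0 \<le> k \<and> k \<le> int n")
  case True
  then have "nat (int n - k) = n - nat k" "nat k \<le> n"
    by (auto simp: nat_diff_distrib)
  then show ?thesis
    using True gbin_symmetric[of "nat k" n] by (simp add: gbin_int_def)
next
  case False
  then have "gbin_int x n (int n - k) = 0" "gbin_int x n k = 0"
    by (auto intro!: gbin_int_eq_0)
  then show ?thesis by simp
qed

lemma gbin_int_Suc: "gbin_int x (Suc n) k = x powi k * gbin_int x n k + gbin_int x n (k - 1)"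
proof (cases "k > 0")
  case True
  define m where "m = nat (k - 1)"
  have "k = int (Suc m)"
    using True by (simp add: m_def)
  then show ?thesis
    by (simp add: gbin_int_def nat_add_distrib power_int_def)
next
  case False
  then show ?thesis
    by (cases "k = 0") (auto simp: gbin_int_def)
qed

lemma gbin_int_Suc':
  "gbin_int x (Suc n) k = gbin_int x n k + x powi (int n + 1 - k) * gbin_int x n (k - 1)"
proof -
  have "gbin_int x (Suc n) k = gbin_int x (Suc n) (int n + 1 - k)"
    using gbin_int_symmetric[of "Suc n" k] by (simp add: algebra_simps)
  also have "\<dots> = x powi (int n + 1 - k) * gbin_int x n (int n - (k - 1)) + gbin_int x n (int n - k)"
    by (simp add: gbin_int_Suc algebra_simps)
  finally show ?thesis
    unfolding gbin_int_symmetric by simp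
qed

text \<open>Joins the terms \<open>m = 2j\<close> and \<open>m = -2j-1\<close> of a finite form of
  Euler's series of \<open>(-1)^m x^(m(3m+1)/2)\<close>. It is used with \<open>l\<close> half of
  \<open>L\<close>, rounded down.\<close>

definition schur_term :: "nat \<Rightarrow> int \<Rightarrow> int \<Rightarrow> 'a" where
  "schur_term L l j = x powi (6 * j\<^sup>2 + j) * gbin_int x L (l - 3 * j)
     - x powi (6 * j\<^sup>2 + 5 * j + 1) * gbin_int x L (l - 3 * j - 1)"

text \<open>The second Pascal rule contributes \<open>u j - u (-j-1)\<close>. The map
  \<open>j -> -j-1\<close> preserves the range \<open>-M..M-1\<close>, so these corrections cancel
  in the sum.\<close>

lemma schur_term_odd: "(\<Sum>j=-M..M-1. schur_term (2 * n + 1) n j) = (\<Sum>j=-M..M-1. schur_term (2 * n) n j)"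
proof -
  define u where "u j = x powi (6 * j\<^sup>2 + 4 * j + int n + 1) * gbin_int x (2 * n) (int n - 3 * j - 1)"
    for j :: int
  have "schur_term (2 * n + 1) n j = schur_term (2 * n) n j + u j - u (- j - 1)" for j
  proof -
    have s: "gbin_int x (2 * n) (int n - 3 * (- j - 1) - 1) = gbin_int x (2 * n) (int n - 3 * j - 2)"
      using gbin_int_symmetric[of "2 * n" "int n - 3 * j - 2"] by (simp add: algebra_simps)
    have e: "6 * (- j - 1)\<^sup>2 + 4 * (- j - 1) + int n + 1 = (6 * j\<^sup>2 + 5 * j + 1) + (int n + 3 * j + 2)"
      "6 * j\<^sup>2 + 4 * j + int n + 1 = (6 * j\<^sup>2 + j) + (int n + 3 * j + 1)"
      by (simp_all add: power2_eq_square algebra_simps)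
    have a: "int (2 * n) + 1 - (int n - 3 * j) = int n + 3 * j + 1"
      "int (2 * n) + 1 - (int n - 3 * j - 1) = int n + 3 * j + 2"
      "int n - 3 * j - 1 - 1 = int n - 3 * j - 2"
      by simp_all
    show ?thesis
      unfolding schur_term_def u_def s e Suc_eq_plus1[symmetric] gbin_int_Suc' a
        power_int_add[OF disjI1[OF nonzero], of "6 * j\<^sup>2 + j" "int n + 3 * j + 1"]
        power_int_add[OF disjI1[OF nonzero], of "6 * j\<^sup>2 + 5 * j + 1" "int n + 3 * j + 2"]
      by (simp only: right_diff_distrib distrib_left mult.assoc) simp
  qed
  moreover have "(\<Sum>j=-M..M-1. u (- j - 1)) = (\<Sum>j=-M..M-1. u j)"
    by (rule sum.reindex_bij_witness[of _ "\<lambda>j. - j - 1" "\<lambda>j. - j - 1"]) auto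
  ultimately show ?thesis
    by (simp add: sum.distrib sum_subtractf)
qed

text \<open>The first Pascal rule contributes \<open>v j - v (-j)\<close>. The map
  \<open>j -> -j\<close> shifts the range by one, and the bound on \<open>M\<close> makes the terms
  at both ends vanish.\<close>

lemma schur_term_even:
  assumes "int n < M"
  shows "(\<Sum>j=-M..M-1. schur_term (2 * n + 2) (int n + 1) j) = (\<Sum>j=-M..M-1. schur_term (2 * n + 1) n j)"
proof -
  define v where "v j = x powi (6 * j\<^sup>2 - 2 * j + int n + 1) * gbin_int x (2 * n + 1) (int n + 1 - 3 * j)"
    for j :: int
  have "schur_term (2 * n + 2) (int n + 1) j = schur_term (2 * n + 1) n j + v j - v (- j)" for j
  proof -
    have s: "gbin_int x (2 * n + 1) (int n + 1 - 3 * (- j)) = gbin_int x (2 * n + 1) (int n - 3 * j)"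
      using gbin_int_symmetric[of "2 * n + 1" "int n - 3 * j"] by (simp add: algebra_simps)
    have e: "6 * (- j)\<^sup>2 - 2 * (- j) + int n + 1 = (6 * j\<^sup>2 + 5 * j + 1) + (int n - 3 * j)"
      "6 * j\<^sup>2 - 2 * j + int n + 1 = (6 * j\<^sup>2 + j) + (int n + 1 - 3 * j)"
      by (simp_all add: power2_eq_square algebra_simps)
    have L: "2 * n + 2 = Suc (2 * n + 1)" by simp
    have a: "int n + 1 - 3 * j - 1 = int n - 3 * j" by simp
    show ?thesis
      unfolding schur_term_def v_def s e L gbin_int_Suc power_int_add[OF disjI1[OF nonzero]] a
      by (simp add: algebra_simps)
  qed
  moreover have "(\<Sum>j=-M..M-1. v (- j)) = (\<Sum>j=-M..M-1. v j)"
  proof -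
    have "(\<Sum>j=-M..M-1. v (- j)) = (\<Sum>j=-M+1..M. v j)"
      by (rule sum.reindex_bij_witness[of _ uminus uminus]) auto
    also have "\<dots> = (\<Sum>j=-M..M-1. v j)"
      by (rule sum.mono_neutral_cong) (use assms in \<open>auto simp: v_def intro!: gbin_int_eq_0\<close>)
    finally show ?thesis .
  qed
  ultimately show ?thesis
    by (simp add: sum.distrib sum_subtractf)
qed

text \<open>The sum is constant as \<open>L\<close> grows in steps of one from \<open>L = 0\<close>,
  where only \<open>j = 0\<close> survives.\<close>

lemma sum_schur_term: "int n < M \<Longrightarrow> (\<Sum>j=-M..M-1. schur_term (2 * n + 1) n j) = 1"
proof (induction n)
  case 0
  have "schur_term 0 0 j = (if j = 0 then 1 else 0)" for j
    by (cases "j < 0") (auto simp: schur_term_def gbin_int_eq_0, simp add: gbin_int_def)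
  with 0 schur_term_odd[of 0 M] show ?case by simp
next
  case (Suc n)
  have "(\<Sum>j=-M..M-1. schur_term (2 * Suc n + 1) (Suc n) j) = (\<Sum>j=-M..M-1. schur_term (2 * n + 2) (int n + 1) j)"
    using schur_term_odd[of "Suc n" M] by (simp add: add.commute)
  also have "\<dots> = 1"
    using Suc schur_term_even[of n M] by simp
  finally show ?case .
qed

text \<open>The bilateral identity folded to \<open>k >= 0\<close>: the block
  \<open>k = 3r, 3r+1, 3r+2\<close> collects the terms \<open>j = r\<close> and
  \<open>j = -r-1\<close>.\<close>

lemma sum_acoef_gbin_int:
  "(\<Sum>k\<le>n. acoef x k * (gbin_int x (2 * n + 1) (int n - int k)
      - x ^ (2 * k + 2) * gbin_int x (2 * n + 1) (int n - int k - 1))) = 1"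
proof -
  define h where "h k = acoef x k * (gbin_int x (2 * n + 1) (int n - int k)
      - x ^ (2 * k + 2) * gbin_int x (2 * n + 1) (int n - int k - 1))" for k
  define M where "M = Suc n"
  have pw: "x ^ m = x powi (int m)" for m
    by simp
  have h_schur: "h (3 * r) + h (Suc (3 * r)) + h (Suc (Suc (3 * r)))
      = schur_term (2 * n + 1) n (int r) + schur_term (2 * n + 1) n (- int r - 1)" for r
  proof -
    let ?r = "int r"
    \<comment> \<open>Reflection moves the binomials at \<open>j = -r-1\<close> to the lower indices
      \<open>n-3r-2\<close> and \<open>n-3r-1\<close>. The exponents split off \<open>6r+4\<close>
      and \<open>6r+2\<close>, the values of \<open>2k+2\<close> at \<open>k = 3r+1\<close> and
      \<open>k = 3r\<close>.\<close>
    have s: "gbin_int x (2 * n + 1) (int n - 3 * (- ?r - 1)) = gbin_int x (2 * n + 1) (int n - 3 * ?r - 2)"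
      "gbin_int x (2 * n + 1) (int n - 3 * (- ?r - 1) - 1) = gbin_int x (2 * n + 1) (int n - 3 * ?r - 1)"
      using gbin_int_symmetric[of "2 * n + 1" "int n - 3 * ?r - 2"]
        gbin_int_symmetric[of "2 * n + 1" "int n - 3 * ?r - 1"] by (simp_all add: algebra_simps)
    have e: "6 * (- ?r - 1)\<^sup>2 + (- ?r - 1) = (6 * ?r\<^sup>2 + 5 * ?r + 1) + (6 * ?r + 4)"
      "6 * (- ?r - 1)\<^sup>2 + 5 * (- ?r - 1) + 1 = (6 * ?r\<^sup>2 + ?r) + (6 * ?r + 2)"
      by (simp_all add: power2_eq_square algebra_simps)
    have i: "int (6 * r\<^sup>2 + r) = 6 * ?r\<^sup>2 + ?r" "int (6 * r\<^sup>2 + 5 * r + 1) = 6 * ?r\<^sup>2 + 5 * ?r + 1"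
      "int (2 * (3 * r) + 2) = 6 * ?r + 2" "int (2 * Suc (3 * r) + 2) = 6 * ?r + 4"
      "int n - int (3 * r) = int n - 3 * ?r" "int n - int (Suc (3 * r)) = int n - 3 * ?r - 1"
      "int n - 3 * ?r - 1 - 1 = int n - 3 * ?r - 2"
      by simp_all
    show ?thesis
      unfolding h_def acoef_3 schur_term_def s e pw i power_int_add[OF disjI1[OF nonzero]]
      by (simp add: algebra_simps)
  qed
  \<comment> \<open>Terms with \<open>k > n\<close> vanish, so the range can be completed to whole
    blocks of three.\<close>
  have "(\<Sum>k\<le>n. h k) = (\<Sum>k<3 * M. h k)"
    by (rule sum.mono_neutral_left) (auto simp: M_def h_def gbin_int_eq_0)
  also have "\<dots> = (\<Sum>r<M. h (3 * r) + h (Suc (3 * r)) + h (Suc (Suc (3 * r))))"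
    by (induction M) (simp_all add: numeral_3_eq_3)
  also have "\<dots> = (\<Sum>r<M. schur_term (2 * n + 1) n (int r) + schur_term (2 * n + 1) n (- int r - 1))"
    by (simp only: h_schur)
  also have "\<dots> = (\<Sum>j=-int M..int M-1. schur_term (2 * n + 1) n j)"
  proof (induction M)
    case (Suc M)
    have "{- int (Suc M)..int (Suc M) - 1} = insert (- int M - 1) (insert (int M) {-int M..int M - 1})"
      by auto
    then show ?case
      using Suc by (simp add: add_ac)
  qed simp
  also have "\<dots> = 1"
    by (rule sum_schur_term) (simp add: M_def)
  finally show ?thesis
    by (simp add: h_def)
qed

text \<open>The kernel of Bailey pairs relative to \<open>x\<close>, up to a factor
  \<open>1 - x\<close>. Its value 0 for \<open>k > n\<close> removes boundary terms.\<close>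

definition star_kernel :: "nat \<Rightarrow> nat \<Rightarrow> 'a" where
  "star_kernel n k = (if k \<le> n then 1 / (qpoch x x (n - k) * qpoch x x (n + k + 1)) else 0)"

lemma gbin_int_star_kernel: "gbin_int x (2 * n + 1) (int n - int k) = qpoch x x (2 * n + 1) * star_kernel n k"
proof (cases "k \<le> n")
  case True
  then have "nat (int n - int k) = n - k" "2 * n + 1 - (n - k) = n + k + 1"
    by auto
  then show ?thesis
    using True gbin_eq_qpoch[of "n - k" "2 * n + 1"] by (simp add: gbin_int_def star_kernel_def mult.commute)
qed (simp add: gbin_int_eq_0 star_kernel_def)

text \<open>Neighbouring kernels relative to \<open>x\<close> combine to the kernel relative to
  \<open>x^2\<close>: over the common denominator the numerator is
  \<open>(1 - x^(n+k+2)) - x^(2k+2) (1 - x^(n-k)) = 1 - x^(2k+2)\<close>.\<close>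

lemma star_kernel_diff:
  assumes "k \<le> n"
  shows "star_kernel n k - x ^ (2 * k + 2) * star_kernel n (Suc k)
    = (1 - x ^ (2 * k + 2)) / (qpoch x x (n - k) * qpoch x x (n + k + 2))"
proof (cases "k = n")
  case True
  have "qpoch x x (n + k + 2) = qpoch x x (n + k + 1) * (1 - x ^ (2 * k + 2))"
    using qpoch_Suc[of x x "n + k + 1"] by (simp add: True mult_2)
  then show ?thesis
    using True power_neq_1[of "2 * n + 2"] by (simp add: star_kernel_def field_simps)
next
  case False
  then obtain d where d: "n = k + Suc d"
    using assms less_imp_Suc_add[of k n] by auto
  have 1: "qpoch x x (n - k) = qpoch x x d * (1 - x ^ Suc d)"
    by (simp add: d qpoch_Suc)
  have 2: "qpoch x x (n + k + 2) = qpoch x x (n + k + 1) * (1 - x ^ (2 * k + d + 3))"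
    using qpoch_Suc[of x x "n + k + 1"] by (simp add: d mult_2 add_ac power_add eval_nat_numeral)
  have k1: "star_kernel n k = 1 / (qpoch x x d * (1 - x ^ Suc d) * qpoch x x (n + k + 1))"
    using assms unfolding star_kernel_def by (simp add: 1)
  have k2: "star_kernel n (Suc k) = 1 / (qpoch x x d * (qpoch x x (n + k + 1) * (1 - x ^ (2 * k + d + 3))))"
    using d 2 unfolding star_kernel_def by (simp add: eval_nat_numeral)
  have nz: "1 - x ^ Suc d \<noteq> 0" "1 - x ^ (2 * k + d + 3) \<noteq> 0"
    using power_neq_1[of "Suc d"] power_neq_1[of "2 * k + d + 3"] by auto
  have gen: "1 / (a * s * b) - y * (1 / (a * (b * t))) = (t - y * s) / (a * s * (b * t))"
    if "a \<noteq> 0" "b \<noteq> 0" "s \<noteq> 0" "t \<noteq> 0" for a b s t y :: 'a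
    using that by (simp add: field_simps)
  have "(1 - x ^ (2 * k + d + 3)) - x ^ (2 * k + 2) * (1 - x ^ Suc d) = 1 - x ^ (2 * k + 2)"
    by (simp add: algebra_simps power_add eval_nat_numeral)
  then show ?thesis
    unfolding k1 k2 1 2 using nz by (subst gen) auto
qed

text \<open>The seed of the chain: the folded identity divided by \<open>(x)_(2n+1)\<close>. Here
  \<open>acoef x k\<close> times \<open>1 - x^(2k+2)\<close> stands for
  \<open>(1 - x^2) alpha_k\<close>.\<close>

lemma bailey_base:
  "1 / qpoch x x (2 * n + 1) = (\<Sum>k\<le>n. acoef x k * (1 - x ^ (2 * k + 2)) / (qpoch x x (n - k) * qpoch x x (n + k + 2)))"
proof -
  have "1 = (\<Sum>k\<le>n. acoef x k * (qpoch x x (2 * n + 1) * star_kernel n k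
      - x ^ (2 * k + 2) * (qpoch x x (2 * n + 1) * star_kernel n (Suc k))))"
    using sum_acoef_gbin_int[of n] unfolding gbin_int_star_kernel[symmetric] by (simp add: algebra_simps)
  also have "\<dots> = qpoch x x (2 * n + 1) * (\<Sum>k\<le>n. acoef x k * (star_kernel n k - x ^ (2 * k + 2) * star_kernel n (Suc k)))"
    by (simp add: sum_distrib_left algebra_simps)
  also have "(\<Sum>k\<le>n. acoef x k * (star_kernel n k - x ^ (2 * k + 2) * star_kernel n (Suc k)))
      = (\<Sum>k\<le>n. acoef x k * (1 - x ^ (2 * k + 2)) / (qpoch x x (n - k) * qpoch x x (n + k + 2)))"
    by (rule sum.cong) (simp_all only: star_kernel_diff atMost_iff times_divide_eq_right)
  finally show ?thesis
    by (simp only: nonzero_divide_eq_eq[OF qpoch_neq_0] mult.commute[of _ "qpoch x x (2 * n + 1)"])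
qed

section \<open>The Bailey chain\<close>

text \<open>A limiting case of q-Chu-Vandermonde with denominators cleared. By Pascal's rule the sum
  for \<open>m+1\<close> is \<open>1 - b x^(m+1)\<close> times the sum at \<open>b\<close> plus
  \<open>b x^(m+1)\<close> times the sum at \<open>b x\<close>; hence \<open>b\<close> varies in the
  induction.\<close>

lemma q_chu_vandermonde:
  "(\<Sum>i\<le>m. gbin x m i * x ^ (i\<^sup>2) * b ^ i * qpoch (b * x ^ Suc i) x (m - i)) = 1"
proof (induction m arbitrary: b)
  case (Suc m)
  define f where "f b i = gbin x m i * x ^ (i\<^sup>2) * b ^ i * qpoch (b * x ^ Suc i) x (m - i)" for b i
  define g where "g i = gbin x m i * x ^ (i\<^sup>2) * b ^ i * qpoch (b * x ^ Suc i) x (Suc m - i)" for i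
  have g: "g i = (1 - b * x ^ Suc m) * f b i" if "i \<le> m" for i
  proof -
    have "qpoch (b * x ^ Suc i) x (Suc m - i) = qpoch (b * x ^ Suc i) x (m - i) * (1 - b * (x ^ Suc i * x ^ (m - i)))"
      using that by (simp add: Suc_diff_le qpoch_Suc mult.assoc)
    also have "x ^ Suc i * x ^ (m - i) = x ^ Suc m"
      using that by (simp flip: power_add)
    finally show ?thesis
      by (simp add: g_def f_def del: power_Suc)
  qed
  have step: "gbin x (Suc m) (Suc i) * x ^ ((Suc i)\<^sup>2) * b ^ Suc i * qpoch (b * x ^ Suc (Suc i)) x (Suc m - Suc i)
      = g (Suc i) + b * x ^ Suc m * f (b * x) i" if "i \<le> m" for i
  proof -
    have e: "x ^ (m - i) * x ^ ((Suc i)\<^sup>2) = x ^ Suc m * (x ^ (i\<^sup>2) * x ^ i)"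
      using that by (simp add: power2_eq_square add_ac flip: power_add power_Suc)
    have "gbin x (Suc m) (Suc i) * x ^ ((Suc i)\<^sup>2) * b ^ Suc i * qpoch (b * x ^ Suc (Suc i)) x (Suc m - Suc i)
       = g (Suc i) + (x ^ (m - i) * x ^ ((Suc i)\<^sup>2)) * gbin x m i * b ^ Suc i * qpoch (b * x ^ Suc (Suc i)) x (m - i)"
      unfolding gbin_Suc_Suc'[OF that] g_def by (simp add: algebra_simps del: power_Suc gbin.simps)
    also have "\<dots> = g (Suc i) + b * x ^ Suc m * f (b * x) i"
      unfolding e f_def by (simp add: power_mult_distrib mult_ac)
    finally show ?thesis .
  qed
  have "(\<Sum>i\<le>Suc m. gbin x (Suc m) i * x ^ (i\<^sup>2) * b ^ i * qpoch (b * x ^ Suc i) x (Suc m - i))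
      = g 0 + (\<Sum>i\<le>m. g (Suc i) + b * x ^ Suc m * f (b * x) i)"
    by (subst sum.atMost_Suc_shift, rule arg_cong2[of _ _ _ _ "(+)"])
      (simp add: g_def, rule sum.cong[OF refl], use step in blast)
  also have "\<dots> = (\<Sum>i\<le>Suc m. g i) + b * x ^ Suc m * (\<Sum>i\<le>m. f (b * x) i)"
    unfolding sum.atMost_Suc_shift[of g] by (simp add: sum.distrib sum_distrib_left)
  \<comment> \<open>The top term vanishes with its binomial, so only \<open>i <= m\<close> remains,
    where the fact \<open>g\<close> applies.\<close>
  also have "(\<Sum>i\<le>Suc m. g i) = (\<Sum>i\<le>m. g i)"
    by (simp add: g_def gbin_eq_0)
  also have "\<dots> = (1 - b * x ^ Suc m) * (\<Sum>i\<le>m. f b i)"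
    by (simp add: g sum_distrib_left)
  finally show ?case
    using Suc by (simp add: f_def)
qed simp

text \<open>Bailey's lemma with both parameters at infinity and \<open>a = x^2\<close>, whose weight
  \<open>a^j x^(j^2)\<close> is \<open>x^(j^2+2j)\<close>. Setting \<open>j = k+i\<close> leaves
  \<open>q_chu_vandermonde\<close> at \<open>b = x^(2k+2)\<close>.\<close>

lemma chain_kernel:
  assumes "k \<le> n"
  shows "(\<Sum>j=k..n. x ^ (j\<^sup>2 + 2 * j) / (qpoch x x (n - j) * (qpoch x x (j - k) * qpoch x x (j + k + 2))))
    = x ^ (k\<^sup>2 + 2 * k) / (qpoch x x (n - k) * qpoch x x (n + k + 2))"
proof -
  define m where "m = n - k"
  have n: "n = k + m"
    using assms by (simp add: m_def)
  have "(\<Sum>j=k..n. x ^ (j\<^sup>2 + 2 * j) / (qpoch x x (n - j) * (qpoch x x (j - k) * qpoch x x (j + k + 2))))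
      = (\<Sum>i\<le>m. x ^ ((k + i)\<^sup>2 + 2 * (k + i)) / (qpoch x x (m - i) * (qpoch x x i * qpoch x x (2 * k + 2 + i))))"
    by (rule sum.reindex_bij_witness[of _ "\<lambda>i. k + i" "\<lambda>j. j - k"]) (auto simp: n mult_2 add_ac)
  also have "\<dots> = (\<Sum>i\<le>m. x ^ (k\<^sup>2 + 2 * k) / (qpoch x x m * qpoch x x (2 * k + 2 + m)) *
      (gbin x m i * x ^ (i\<^sup>2) * (x ^ (2 * k + 2)) ^ i * qpoch (x ^ (2 * k + 2) * x ^ Suc i) x (m - i)))"
  proof (rule sum.cong)
    fix i assume "i \<in> {..m}"
    then have i: "i \<le> m" by simp
    have q: "qpoch x x (2 * k + 2 + m)
        = qpoch x x (2 * k + 2 + i) * qpoch (x ^ (2 * k + 2) * x ^ Suc i) x (m - i)"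
      using qpoch_add[of x x "2 * k + 2 + i" "m - i"] i by (simp add: power_add mult_ac)
    have nz: "qpoch (x ^ (2 * k + 2) * x ^ Suc i) x (m - i) \<noteq> 0"
      using q qpoch_neq_0[of "2 * k + 2 + m"] by auto
    have e: "x ^ ((k + i)\<^sup>2 + 2 * (k + i)) = x ^ (k\<^sup>2 + 2 * k) * (x ^ (i\<^sup>2) * (x ^ (2 * k + 2)) ^ i)"
      by (simp add: power2_eq_square algebra_simps flip: power_add power_mult)
    have gen: "A * (B * C) / (a * (b * c)) = A / (d * (c * f)) * (d / (a * b) * B * C * f)"
      if "a \<noteq> 0" "b \<noteq> 0" "c \<noteq> 0" "d \<noteq> 0" "f \<noteq> 0" for A B C a b c d f :: 'a
      using that by (simp add: field_simps)
    show "x ^ ((k + i)\<^sup>2 + 2 * (k + i)) / (qpoch x x (m - i) * (qpoch x x i * qpoch x x (2 * k + 2 + i)))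
      = x ^ (k\<^sup>2 + 2 * k) / (qpoch x x m * qpoch x x (2 * k + 2 + m)) *
      (gbin x m i * x ^ (i\<^sup>2) * (x ^ (2 * k + 2)) ^ i * qpoch (x ^ (2 * k + 2) * x ^ Suc i) x (m - i))"
      unfolding e q gbin_eq_qpoch[OF i] by (rule gen) (use nz in auto)
  qed simp
  also have "\<dots> = x ^ (k\<^sup>2 + 2 * k) / (qpoch x x m * qpoch x x (2 * k + 2 + m))"
    by (simp only: sum_distrib_left[symmetric] q_chu_vandermonde mult_1_right)
  finally show ?thesis
    by (simp add: n mult_2 add_ac)
qed

end

text \<open>The factor \<open>1 - x\<close> is absorbed: at \<open>p = 0\<close> the value is \<open>1 / (x)\<^bsub>2n+1\<^esub>\<close>, not \<open>1 / (x\<^sup>2)\<^bsub>2n\<^esub>\<close>.\<close>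

fun bailey_beta :: "'a::field \<Rightarrow> nat \<Rightarrow> nat \<Rightarrow> 'a" where
  "bailey_beta x 0 n = 1 / qpoch x x (2 * n + 1)"
| "bailey_beta x (Suc p) n = (\<Sum>j\<le>n. x ^ (j\<^sup>2 + 2 * j) / qpoch x x (n - j) * bailey_beta x p j)"

definition chain_coef :: "'a::comm_ring_1 \<Rightarrow> nat \<Rightarrow> nat \<Rightarrow> 'a" where
  "chain_coef x p k = x ^ (p * (k\<^sup>2 + 2 * k)) * acoef x k"

text \<open>The starred sequence of the theorem after cancellation, a polynomial in
  \<open>x\<close>.\<close>

definition star_coef :: "'a::comm_ring_1 \<Rightarrow> nat \<Rightarrow> nat \<Rightarrow> 'a" where
  "star_coef x p k = chain_coef x p k - (if k = 0 then 0 else x ^ (2 * k) * chain_coef x p (k - 1))"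

lemma tendsto_star_coef [tendsto_intros]:
  fixes f :: "'b \<Rightarrow> 'a::{comm_ring_1,real_normed_algebra_1}"
  assumes "(f \<longlongrightarrow> a) F"
  shows "((\<lambda>x. star_coef (f x) p k) \<longlongrightarrow> star_coef a p k) F"
  unfolding star_coef_def chain_coef_def by (cases "k = 0") (auto intro!: tendsto_intros assms)

section \<open>The iterated chain and the star operation\<close>

context generic_base
begin

text \<open>Each chain step swaps a triangular sum and applies \<open>chain_kernel\<close>, which
  multiplies the \<open>k\<close>-th coefficient by \<open>x^(k^2+2k)\<close>.\<close>

lemma bailey_chain:
  "bailey_beta x p n
    = (\<Sum>k\<le>n. chain_coef x p k * ((1 - x ^ (2 * k + 2)) / (qpoch x x (n - k) * qpoch x x (n + k + 2))))"
proof (induction p arbitrary: n)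
  case 0
  show ?case
    using bailey_base[of n] by (simp add: chain_coef_def)
next
  case (Suc p)
  define c where "c k = chain_coef x p k * (1 - x ^ (2 * k + 2))" for k
  have "bailey_beta x (Suc p) n
      = (\<Sum>j\<le>n. \<Sum>k\<le>j. c k * (x ^ (j\<^sup>2 + 2 * j) / (qpoch x x (n - j) * (qpoch x x (j - k) * qpoch x x (j + k + 2)))))"
    by (simp add: Suc c_def sum_distrib_left mult_ac del: power_Suc)
  also have "\<dots> = (\<Sum>k\<le>n. \<Sum>j=k..n. c k * (x ^ (j\<^sup>2 + 2 * j) / (qpoch x x (n - j) * (qpoch x x (j - k) * qpoch x x (j + k + 2)))))"
    by (rule sum_triangle_swap)
  also have "\<dots> = (\<Sum>k\<le>n. c k * (x ^ (k\<^sup>2 + 2 * k) / (qpoch x x (n - k) * qpoch x x (n + k + 2))))"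
    by (rule sum.cong) (simp_all only: sum_distrib_left[symmetric] chain_kernel atMost_iff)
  also have "\<dots> = (\<Sum>k\<le>n. chain_coef x (Suc p) k * ((1 - x ^ (2 * k + 2)) / (qpoch x x (n - k) * qpoch x x (n + k + 2))))"
    by (simp add: c_def chain_coef_def power_add mult_ac)
  finally show ?case .
qed

text \<open>Summation by parts, which passes from the Bailey parameter \<open>q\<^sup>2\<close> to \<open>q\<close>.\<close>

lemma bailey_star:
  "bailey_beta x p n = (\<Sum>k\<le>n. star_coef x p k / (qpoch x x (n - k) * qpoch x x (n + k + 1)))"
proof -
  have parts: "(\<Sum>k\<le>m. chain_coef x p k * (star_kernel n k - x ^ (2 * k + 2) * star_kernel n (Suc k)))
      = (\<Sum>k\<le>m. star_coef x p k * star_kernel n k) - x ^ (2 * m + 2) * chain_coef x p m * star_kernel n (Suc m)" for m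
    by (induction m) (simp_all add: star_coef_def algebra_simps)
  have "bailey_beta x p n = (\<Sum>k\<le>n. chain_coef x p k * (star_kernel n k - x ^ (2 * k + 2) * star_kernel n (Suc k)))"
    unfolding bailey_chain by (rule sum.cong) (simp_all only: star_kernel_diff atMost_iff)
  \<comment> \<open>At \<open>m = n\<close> the boundary term contains
    \<open>star_kernel n (Suc n) = 0\<close>.\<close>
  also have "\<dots> = (\<Sum>k\<le>n. star_coef x p k * star_kernel n k)"
    unfolding parts by (simp add: star_kernel_def)
  finally show ?thesis
    by (simp add: star_kernel_def)
qed

text \<open>The factor \<open>1 - x^(2k+2)\<close> of \<open>alpha\<close> cancels the denominator,
  which is nonzero at generic \<open>x\<close>. The case \<open>x = qvar\<close> is the
  simplification as rational functions.\<close>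

lemma star_alpha: "star x (\<lambda>j. x ^ (p * (j\<^sup>2 + 2 * j)) * alpha x j) k = star_coef x p k"
proof -
  have nz: "1 - x ^ j \<noteq> 0" if "j > 0" for j
    using power_neq_1[OF that] by simp
  have alpha: "(1 - x ^ 2) * alpha x k = (1 - x ^ (2 * k + 2)) * acoef x k" for k
  proof -
    have "1 - x ^ 2 \<noteq> 0"
      by (rule nz) simp
    define r where "r = k div 3"
    consider "k = 3 * r" | "k = Suc (3 * r)" | "k = Suc (Suc (3 * r))"
      unfolding r_def by linarith
    then show ?thesis
    proof cases
      case 1
      have e: "2 * (3 * r) + 2 = 6 * r + 2" by simp
      show ?thesis
        unfolding 1 alpha_3 acoef_3 e using \<open>1 - x ^ 2 \<noteq> 0\<close> by simp
    next
      case 2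
      have e: "2 * Suc (3 * r) + 2 = 6 * r + 4" by simp
      show ?thesis
        unfolding 2 alpha_3 acoef_3 e using \<open>1 - x ^ 2 \<noteq> 0\<close> by simp
    next
      case 3
      show ?thesis
        unfolding 3 alpha_3 acoef_3 by simp
    qed
  qed
  have quot: "(1 - x ^ 2) * (x ^ (p * (k\<^sup>2 + 2 * k)) * alpha x k / (1 - x ^ (2 * k + 2))) = chain_coef x p k" for k
  proof -
    have "(1 - x ^ 2) * (x ^ (p * (k\<^sup>2 + 2 * k)) * alpha x k / (1 - x ^ (2 * k + 2)))
       = x ^ (p * (k\<^sup>2 + 2 * k)) * ((1 - x ^ 2) * alpha x k) / (1 - x ^ (2 * k + 2))"
      by simp
    then show ?thesis
      unfolding alpha chain_coef_def using nz[of "2 * k + 2"] by simp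
  qed
  show ?thesis
  proof (cases k)
    case 0
    then show ?thesis
      using quot[of 0] by (simp add: star_def star_coef_def)
  next
    case (Suc j)
    have "star x (\<lambda>j. x ^ (p * (j\<^sup>2 + 2 * j)) * alpha x j) k
       = (1 - x ^ 2) * (x ^ (p * (k\<^sup>2 + 2 * k)) * alpha x k / (1 - x ^ (2 * k + 2)))
        - x ^ (2 * k) * ((1 - x ^ 2) * (x ^ (p * (j\<^sup>2 + 2 * j)) * alpha x j / (1 - x ^ (2 * j + 2))))"
      by (simp add: star_def Suc right_diff_distrib mult_ac)
    then show ?thesis
      unfolding quot by (simp add: star_coef_def Suc)
  qed
qed

end

lemma eval_ratfun_star:
  "eval_ratfun (star qvar (\<lambda>j. qvar ^ (p * (j\<^sup>2 + 2 * j)) * alpha qvar j) k) x = star_coef x p k"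
proof -
  have pow: "to_fract (f ^ m) = to_fract f ^ m" for f :: "complex poly" and m
    by (induction m) simp_all
  have "acoef (to_fract f) j = to_fract (acoef f j)" for f :: "complex poly" and j
    by (simp add: acoef_def Let_def pow)
  then have "chain_coef (to_fract f) p j = to_fract (chain_coef f p j)" for f :: "complex poly" and j
    by (simp add: chain_coef_def pow)
  then have "star_coef (to_fract f) p k = to_fract (star_coef f p k)" for f :: "complex poly"
    by (simp add: star_coef_def pow)
  then have "star_coef qvar p k = to_fract (star_coef [:0, 1:] p k)"
    by (simp add: qvar_def)
  moreover have "poly (acoef [:0, 1:] j) x = acoef x j" for j
    by (simp add: acoef_def Let_def poly_power)
  then have "poly (star_coef [:0, 1:] p k) x = star_coef x p k"
    by (simp add: star_coef_def chain_coef_def poly_power)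
  ultimately show ?thesis
    by (simp add: generic_base.star_alpha[OF generic_base_qvar] eval_ratfun_to_fract)
qed

section \<open>Reversal of the multisum\<close>

text \<open>The sum over chains \<open>m = n_p >= ... >= n_1\<close> of weights and Gaussian
  binomials. The delta at 0 ends a chain neutrally, since \<open>gbin x m 0 = 1\<close>.\<close>

fun nested :: "'a::comm_ring_1 \<Rightarrow> (nat \<Rightarrow> 'a) \<Rightarrow> nat \<Rightarrow> nat \<Rightarrow> 'a" where
  "nested x w 0 m = (if m = 0 then 1 else 0)"
| "nested x w (Suc p) m = w m * (\<Sum>j\<le>m. gbin x m j * nested x w p j)"

lemma nested_scale: "nested x (\<lambda>m. c * w m) p m = c ^ p * nested x w p m"
  by (induction p arbitrary: m) (simp_all add: sum_distrib_left mult_ac)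

lemma nested_cong:
  "(\<And>j. j \<le> m \<Longrightarrow> v j = w j) \<Longrightarrow> nested x v p m = nested x w p m"
  by (induction p arbitrary: m) simp_all

lemma tendsto_nested [tendsto_intros]:
  fixes f :: "'b \<Rightarrow> 'a::{comm_ring_1,real_normed_algebra_1}"
  assumes "(f \<longlongrightarrow> a) F" "\<And>m. ((\<lambda>x. w x m) \<longlongrightarrow> v m) F"
  shows "((\<lambda>x. nested (f x) (w x) p m) \<longlongrightarrow> nested a v p m) F"
proof (induction p arbitrary: m)
  case (Suc p)
  then show ?case
    by (auto intro!: tendsto_intros assms)
qed simp

text \<open>In the complementary indices \<open>m = n - j\<close> the reciprocal q-factorials become
  Gaussian binomials over \<open>(x)_m\<close>. The induction moves one chain step at a time from
  \<open>bailey_beta\<close> into \<open>nested\<close>, so \<open>r\<close> varies.\<close>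

lemma (in generic_base) bailey_beta_reverse:
  "bailey_beta x (p + r) n
    = (\<Sum>m\<le>n. nested x (\<lambda>m. x ^ ((n - m)\<^sup>2 + 2 * (n - m))) p m / qpoch x x m * bailey_beta x r (n - m))"
proof (induction p arbitrary: r)
  case 0
  have "(\<Sum>m\<le>n. nested x (\<lambda>m. x ^ ((n - m)\<^sup>2 + 2 * (n - m))) 0 m / qpoch x x m * bailey_beta x r (n - m))
     = (\<Sum>m\<le>n. if m = 0 then bailey_beta x r n else 0)"
    by (intro sum.cong) auto
  then show ?case by simp
next
  case (Suc p)
  define w where "w = (\<lambda>m. x ^ ((n - m)\<^sup>2 + 2 * (n - m)))"
  have "bailey_beta x (Suc p + r) n = (\<Sum>j\<le>n. nested x w p j / qpoch x x j * bailey_beta x (Suc r) (n - j))"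
    using Suc[of "Suc r"] by (simp only: w_def add_Suc add_Suc_right)
  also have "\<dots> = (\<Sum>j\<le>n. nested x w p j / qpoch x x j *
      (\<Sum>m=j..n. w m / qpoch x x (m - j) * bailey_beta x r (n - m)))"
  proof (intro sum.cong refl arg_cong2[of _ _ _ _ "(*)"])
    fix j assume "j \<in> {..n}"
    show "bailey_beta x (Suc r) (n - j) = (\<Sum>m=j..n. w m / qpoch x x (m - j) * bailey_beta x r (n - m))"
      unfolding bailey_beta.simps w_def
      by (rule sum.reindex_bij_witness[of _ "\<lambda>m. n - m" "\<lambda>i. n - i"]) (use \<open>j \<in> {..n}\<close> in \<open>auto simp: add.commute\<close>)
  qed
  also have "\<dots> = (\<Sum>j\<le>n. \<Sum>m=j..n. w m * (nested x w p j / (qpoch x x (m - j) * qpoch x x j)) * bailey_beta x r (n - m))"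
    by (simp add: sum_distrib_left mult_ac)
  also have "\<dots> = (\<Sum>m\<le>n. \<Sum>j\<le>m. w m * (nested x w p j / (qpoch x x (m - j) * qpoch x x j)) * bailey_beta x r (n - m))"
    by (rule sum_triangle_swap[symmetric])
  also have "\<dots> = (\<Sum>m\<le>n. nested x w (Suc p) m / qpoch x x m * bailey_beta x r (n - m))"
  proof (rule sum.cong)
    fix m
    have "nested x w (Suc p) m / qpoch x x m
        = (\<Sum>j\<le>m. w m * (nested x w p j / (qpoch x x (m - j) * qpoch x x j)))"
      by (simp add: gbin_eq_qpoch sum_distrib_left sum_divide_distrib field_simps)
    then show "(\<Sum>j\<le>m. w m * (nested x w p j / (qpoch x x (m - j) * qpoch x x j)) * bailey_beta x r (n - m))
      = nested x w (Suc p) m / qpoch x x m * bailey_beta x r (n - m)"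
      by (simp add: sum_distrib_right)
  qed simp
  finally show ?case
    by (simp add: w_def)
qed

section \<open>Sums over monotone tuples\<close>

definition tuples_last :: "nat \<Rightarrow> nat \<Rightarrow> (nat \<Rightarrow> nat) set" where
  "tuples_last p m = {n \<in> mono_tuples p. n p = m}"

lemma tuples_last_1: "tuples_last (Suc 0) m = {\<lambda>i\<in>{1..1}. m}"
proof -
  have "n = (\<lambda>i\<in>{1..1}. n (Suc 0))" if "n \<in> {1..Suc 0} \<rightarrow>\<^sub>E UNIV" for n :: "nat \<Rightarrow> nat"
    using that by (auto simp: fun_eq_iff PiE_def extensional_def restrict_def)
  then show ?thesis
    by (auto simp: tuples_last_def mono_tuples_def split: if_splits)
qed

text \<open>Appends \<open>m\<close> to a tuple ending in some \<open>j <= m\<close>. The inverse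
  restores \<open>undefined\<close>, since tuples are extensional functions.\<close>

lemma tuples_last_Suc:
  "bij_betw (\<lambda>(j, n). n(Suc (Suc p) := m)) (SIGMA j:{..m}. tuples_last (Suc p) j) (tuples_last (Suc (Suc p)) m)"
proof (rule bij_betw_byWitness[where f' = "\<lambda>n. (n (Suc p), n(Suc (Suc p) := undefined))"], goal_cases)
  case 1
  show ?case
    by (auto simp: tuples_last_def mono_tuples_def PiE_def extensional_def fun_eq_iff)
next
  case 2
  show ?case
    by (auto simp: tuples_last_def)
next
  case 3
  show ?case
    by (auto simp: tuples_last_def mono_tuples_def PiE_def extensional_def)
next
  case 4
  show ?case
    by (auto simp: tuples_last_def mono_tuples_def PiE_def extensional_def)
qed

lemma finite_tuples_last: "finite (tuples_last (Suc p) m)"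
proof (induction p arbitrary: m)
  case 0
  show ?case by (simp add: tuples_last_1)
next
  case (Suc p)
  then show ?case
    using bij_betw_finite[OF tuples_last_Suc, of m p] by auto
qed

text \<open>The product stops below the top index, hence the separate factor \<open>w m\<close>.
  Induction follows the appending bijection.\<close>

lemma sum_tuples_last:
  "w m * (\<Sum>n\<in>tuples_last (Suc p) m. \<Prod>i\<in>{1..<Suc p}. w (n i) * gbin q (n (i + 1)) (n i)) = nested q w (Suc p) m"
proof (induction p arbitrary: m)
  case 0
  have "(\<Sum>j\<le>m. gbin q m j * (if j = 0 then 1 else 0)) = (\<Sum>j\<le>m. if j = 0 then 1 else 0)"
    by (intro sum.cong) auto
  then show ?case
    by (simp add: tuples_last_1)
next
  case (Suc p)
  define W where "W p n = (\<Prod>i\<in>{1..<p}. w (n i) * gbin q (n (i + 1)) (n i))" for p and n :: "nat \<Rightarrow> nat"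
  have W: "W (Suc (Suc p)) (n(Suc (Suc p) := m)) = W (Suc p) n * (w j * gbin q m j)"
    if "n \<in> tuples_last (Suc p) j" for n j
  proof -
    have "W (Suc p) (n(Suc (Suc p) := m)) = W (Suc p) n"
      unfolding W_def by (intro prod.cong) auto
    with that show ?thesis
      by (simp add: W_def tuples_last_def)
  qed
  have "(\<Sum>n\<in>tuples_last (Suc (Suc p)) m. W (Suc (Suc p)) n)
      = (\<Sum>(j, n)\<in>(SIGMA j:{..m}. tuples_last (Suc p) j). W (Suc (Suc p)) (n(Suc (Suc p) := m)))"
    by (subst sum.reindex_bij_betw[OF tuples_last_Suc, symmetric]) (simp add: case_prod_beta)
  also have "\<dots> = (\<Sum>j\<le>m. \<Sum>n\<in>tuples_last (Suc p) j. W (Suc (Suc p)) (n(Suc (Suc p) := m)))"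
    by (subst sum.Sigma) (auto simp: finite_tuples_last)
  also have "\<dots> = (\<Sum>j\<le>m. gbin q m j * (w j * (\<Sum>n\<in>tuples_last (Suc p) j. W (Suc p) n)))"
    by (simp add: W sum_distrib_left mult_ac)
  also have "\<dots> = (\<Sum>j\<le>m. gbin q m j * nested q w (Suc p) j)"
    using Suc by (simp add: W_def)
  finally show ?case
    by (simp only: W_def nested.simps(2)[of q w "Suc p"])
qed

section \<open>The limit at a root of unity\<close>

context
  fixes N :: nat and q :: complex
  assumes N: "N \<ge> 1" and root: "primitive_unity_root N q"
begin

lemma root_power_N: "q ^ N = 1"
  using root by (simp add: primitive_unity_root_def)

lemma root_nonzero: "q \<noteq> 0"
  using root_power_N N by (auto simp: power_0_left)

lemma root_norm: "norm q = 1"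
  using root_power_N N by (metis norm_one norm_power norm_ge_zero power_eq_1_iff not_one_le_zero)

lemma root_qpoch_nonzero: "k < N \<Longrightarrow> qpoch q q k \<noteq> 0"
  using root by (intro qpoch_nonzero) (auto simp: primitive_unity_root_def)

lemma root_qpoch_N: "qpoch q q N = 0"
  using N root_power_N by (intro qpoch_eq_0[of "N - 1"]) (auto simp flip: power_Suc)

text \<open>The source of the sign and the power in the theorem:
  \<open>1 - q^(N-j) = - q^(-j) (1 - q^j)\<close> for \<open>j = 1..k\<close>, and these
  \<open>j\<close> add up to \<open>k(k+1)/2\<close>.\<close>

lemma root_qpoch_reflect:
  "k < N \<Longrightarrow> qpoch q q (N - 1) = qpoch q q (N - 1 - k) * ((-1) ^ k * q powi (- int ((k + 1) choose 2)) * qpoch q q k)"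
proof (induction k)
  case 0
  show ?case by (simp add: binomial_eq_0)
next
  case (Suc k)
  have "N - 1 - k = Suc (N - 1 - Suc k)"
    using Suc by simp
  then have s: "qpoch q q (N - 1 - k) = qpoch q q (N - 1 - Suc k) * (1 - q ^ (N - 1 - k))"
    by (simp add: qpoch_Suc)
  have "q ^ (N - 1 - k) * q ^ Suc k = 1"
    using Suc root_power_N by (simp flip: power_add power_Suc)
  then have r: "1 - q ^ (N - 1 - k) = - (q powi (- int (Suc k))) * (1 - q ^ Suc k)"
    using root_nonzero by (simp add: power_int_minus field_simps del: power_Suc of_nat_Suc)
  have c: "- int ((Suc k + 1) choose 2) = - int ((k + 1) choose 2) + - int (Suc k)"
    by (simp add: eval_nat_numeral)
  have "qpoch q q (N - 1) = qpoch q q (N - 1 - k) * ((-1) ^ k * q powi (- int ((k + 1) choose 2)) * qpoch q q k)"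
    using Suc by simp
  then show ?case
    unfolding c power_int_add[OF disjI1[OF root_nonzero]] s r qpoch_Suc
    by (simp only: power_Suc mult_minus_left mult_minus_right mult_1_left mult_ac)
qed

text \<open>Points of the open unit disc are never roots of unity.\<close>

abbreviation appr :: "complex filter" where
  "appr \<equiv> at q within ball 0 1"

text \<open>\<open>q\<close> lies on the unit circle, so it is a limit point of the disc; limits
  along \<open>appr\<close> are therefore unique.\<close>

lemma appr_nontrivial: "appr \<noteq> bot"
  using root_norm by (simp add: trivial_limit_within islimpt_ball)

lemma appr_tendsto [tendsto_intros]: "((\<lambda>x. x) \<longlongrightarrow> q) appr"
  by (rule tendsto_ident_at)

lemma appr_generic: "eventually generic_base appr"
proof -
  have "eventually (\<lambda>x. x \<noteq> 0) appr"
    using appr_tendsto root_nonzero by (rule tendsto_imp_eventually_ne)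
  moreover have "eventually (\<lambda>x. x \<in> ball 0 1) appr"
    by (simp add: eventually_at_filter)
  ultimately show ?thesis
  proof eventually_elim
    case (elim x)
    show ?case
    proof
      fix j :: nat assume "0 < j"
      then have "norm (x ^ j) < 1"
        using elim by (simp add: norm_power power_less_one_iff)
      then show "x ^ j \<noteq> 1"
        by auto
    qed (use elim in auto)
  qed
qed

section \<open>Two evaluations of one limit\<close>

lemma qpoch_above_N: "qpoch x x (N + k) = qpoch x x N * qpoch (x ^ Suc N) x k"
  by (simp add: qpoch_add)

lemma root_power_Suc_N: "q ^ Suc N = q"
  by (simp add: root_power_N)

text \<open>The denominators \<open>(x)_(N+k)\<close> in \<open>bailey_star\<close> at
  \<open>n = N-1\<close> tend to 0; the factor \<open>(x)_N\<close> compensates for this.\<close>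

definition normalized_beta :: "nat \<Rightarrow> complex \<Rightarrow> complex" where
  "normalized_beta p x = qpoch x x (N - 1) * qpoch x x N * bailey_beta x p (N - 1)"

text \<open>Since \<open>(x)_(N+k) = (x)_N (x^(N+1))_k\<close> and \<open>x^(N+1)\<close> tends to
  \<open>q\<close>, the coefficients tend to \<open>(q)_(N-1) / ((q)_(N-1-k) (q)_k)\<close>, which
  reflection evaluates.\<close>

lemma normalized_beta_tendsto_star:
  "(normalized_beta p \<longlongrightarrow> (\<Sum>k=0..N-1. (-1) ^ k * q powi (- int ((k + 1) choose 2)) * star_coef q p k)) appr"
proof -
  have "((\<lambda>x. \<Sum>k=0..N-1. qpoch x x (N - 1) / (qpoch x x (N - 1 - k) * qpoch (x ^ Suc N) x k) * star_coef x p k)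
      \<longlongrightarrow> (\<Sum>k=0..N-1. qpoch q q (N - 1) / (qpoch q q (N - 1 - k) * qpoch (q ^ Suc N) q k) * star_coef q p k)) appr"
    using N by (intro tendsto_intros) (auto simp: root_power_N root_qpoch_nonzero)
  also have "(\<Sum>k=0..N-1. qpoch q q (N - 1) / (qpoch q q (N - 1 - k) * qpoch (q ^ Suc N) q k) * star_coef q p k)
     = (\<Sum>k=0..N-1. (-1) ^ k * q powi (- int ((k + 1) choose 2)) * star_coef q p k)"
  proof (rule sum.cong)
    fix k assume "k \<in> {0..N-1}"
    then have k: "k < N"
      using N by auto
    then have "qpoch q q (N - 1 - k) \<noteq> 0" "qpoch q q k \<noteq> 0"
      by (auto simp: root_qpoch_nonzero)
    then have "qpoch q q (N - 1) / (qpoch q q (N - 1 - k) * qpoch (q ^ Suc N) q k) = (-1) ^ k * q powi (- int ((k + 1) choose 2))"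
      unfolding root_power_Suc_N by (subst root_qpoch_reflect[OF k]) (simp add: field_simps)
    then show "qpoch q q (N - 1) / (qpoch q q (N - 1 - k) * qpoch (q ^ Suc N) q k) * star_coef q p k
      = (-1) ^ k * q powi (- int ((k + 1) choose 2)) * star_coef q p k"
      by simp
  qed simp
  finally show ?thesis
  proof (rule Lim_transform_eventually)
    show "\<forall>\<^sub>F x in appr. (\<Sum>k=0..N-1. qpoch x x (N - 1) / (qpoch x x (N - 1 - k) * qpoch (x ^ Suc N) x k) * star_coef x p k) = normalized_beta p x"
      using appr_generic
    proof eventually_elim
      case (elim x)
      interpret generic_base x by fact
      have "qpoch x x (N - 1 + k + 1) = qpoch x x N * qpoch (x ^ Suc N) x k" for k
        using N qpoch_above_N[of x k] by simp
      then show ?case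
        by (simp add: normalized_beta_def bailey_star sum_distrib_left atLeast0AtMost mult_ac del: power_Suc)
    qed
  qed
qed

lemma qpoch_ratio_tendsto:
  assumes "m < N"
  shows "((\<lambda>x. qpoch x x (N - 1) * qpoch x x N / (qpoch x x m * qpoch x x (2 * (N - 1 - m) + 1)))
    \<longlongrightarrow> q powi (- int (2 * m\<^sup>2 + m)) * qpoch (q ^ (m + 1)) q m) appr"
proof (cases "2 * m < N")
  case True
  \<comment> \<open>Here \<open>2(N-1-m)+1 = N+d\<close>, so \<open>(x)_N\<close> cancels. The limit
    follows by reflection at \<open>k = 2m\<close>, with sign +1 and exponent
    \<open>2m^2+m\<close>.\<close>
  define d where "d = N - 1 - 2 * m"
  have d: "2 * (N - 1 - m) + 1 = N + d" "d < N"
    using True N by (auto simp: d_def)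
  have "((\<lambda>x. qpoch x x (N - 1) / (qpoch x x m * qpoch (x ^ Suc N) x d))
    \<longlongrightarrow> qpoch q q (N - 1) / (qpoch q q m * qpoch (q ^ Suc N) q d)) appr"
    using assms d by (intro tendsto_intros) (auto simp: root_power_N root_qpoch_nonzero)
  also have "qpoch q q (N - 1) / (qpoch q q m * qpoch (q ^ Suc N) q d)
      = q powi (- int (2 * m\<^sup>2 + m)) * qpoch (q ^ (m + 1)) q m"
  proof -
    have ch: "(2 * m + 1) choose 2 = 2 * m\<^sup>2 + m"
      by (simp add: choose_two power2_eq_square algebra_simps)
    have q2: "qpoch q q (2 * m) = qpoch q q m * qpoch (q ^ (m + 1)) q m"
      using qpoch_add[of q q m m] by (simp add: mult_2)
    have "qpoch q q d \<noteq> 0" "qpoch q q m \<noteq> 0"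
      using assms d by (auto simp: root_qpoch_nonzero)
    then show ?thesis
      using root_qpoch_reflect[OF True] unfolding root_power_Suc_N ch q2 d_def[symmetric]
      by (simp add: field_simps)
  qed
  finally show ?thesis
  proof (rule Lim_transform_eventually)
    show "\<forall>\<^sub>F x in appr. qpoch x x (N - 1) / (qpoch x x m * qpoch (x ^ Suc N) x d)
        = qpoch x x (N - 1) * qpoch x x N / (qpoch x x m * qpoch x x (2 * (N - 1 - m) + 1))"
      using appr_generic
    proof eventually_elim
      case (elim x)
      interpret generic_base x by fact
      show ?case
        unfolding d(1) qpoch_above_N by (simp del: power_Suc)
    qed
  qed
next
  case False
  \<comment> \<open>Now \<open>2(N-1-m)+1 < N\<close>: the denominator stays nonzero and
    \<open>(q)_N = 0\<close> gives limit 0. The right side vanishes too, as \<open>q^N\<close> is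
    among \<open>q^(m+1), ..., q^(2m)\<close>.\<close>
  have "q ^ (m + 1) * q ^ (N - m - 1) = 1"
    using assms root_power_N by (simp flip: power_add power_Suc)
  then have "qpoch (q ^ (m + 1)) q m = 0"
    using False assms by (intro qpoch_eq_0[of "N - m - 1"]) auto
  moreover have "((\<lambda>x. qpoch x x (N - 1) * qpoch x x N / (qpoch x x m * qpoch x x (2 * (N - 1 - m) + 1)))
    \<longlongrightarrow> qpoch q q (N - 1) * qpoch q q N / (qpoch q q m * qpoch q q (2 * (N - 1 - m) + 1))) appr"
    using assms False by (intro tendsto_intros) (auto simp: root_qpoch_nonzero)
  ultimately show ?thesis
    by (simp add: root_qpoch_N)
qed

lemma normalized_beta_tendsto_nested:
  "(normalized_beta p \<longlongrightarrow> q powi (- int p) *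
    (\<Sum>m<N. q powi (- int (2 * m\<^sup>2 + m)) * qpoch (q ^ (m + 1)) q m * nested q (\<lambda>m. q ^ (m\<^sup>2)) p m)) appr"
proof -
  define e where "e m = (N - 1 - m)\<^sup>2 + 2 * (N - 1 - m)" for m
  \<comment> \<open>The exponent is \<open>(N-m)^2 - 1\<close>, congruent to \<open>m^2 - 1\<close>
    modulo \<open>N\<close>.\<close>
  have e: "q ^ e m = inverse q * q ^ (m\<^sup>2)" if "m < N" for m
  proof -
    define l where "l = N - 1 - m"
    have "e m + 1 = (l + 1)\<^sup>2"
      unfolding e_def l_def[symmetric] by (simp add: power2_eq_square)
    then have "q ^ (e m + 1) = q ^ ((l + 1)\<^sup>2)"
      by simp
    also have "l + 1 = N - m"
      using that by (simp add: l_def)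
    also have "q ^ ((N - m)\<^sup>2) = q ^ (m\<^sup>2)"
    proof -
      have "(N - m)\<^sup>2 + N * (2 * m) = m\<^sup>2 + N * N"
      proof -
        obtain t where "N = m + t"
          using \<open>m < N\<close> less_imp_add_positive by blast
        then show ?thesis
          by (simp add: power2_eq_square algebra_simps)
      qed
      then have "q ^ ((N - m)\<^sup>2) * q ^ (N * (2 * m)) = q ^ (m\<^sup>2) * q ^ (N * N)"
        by (simp only: power_add[symmetric])
      then show ?thesis
        by (simp add: power_mult root_power_N)
    qed
    finally show ?thesis
      using root_nonzero by (simp add: field_simps)
  qed
  \<comment> \<open>Each of the \<open>p\<close> weights carries one factor \<open>1/q\<close>,
    which yields \<open>q^(-p)\<close>.\<close>
  have nested: "nested q (\<lambda>m. q ^ e m) p m = q powi (- int p) * nested q (\<lambda>m. q ^ (m\<^sup>2)) p m" if "m < N" for m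
  proof -
    have "nested q (\<lambda>m. q ^ e m) p m = nested q (\<lambda>m. inverse q * q ^ (m\<^sup>2)) p m"
      using that by (intro nested_cong) (auto simp: e)
    then show ?thesis
      by (simp add: nested_scale power_int_minus power_inverse)
  qed
  have "((\<lambda>x. \<Sum>m<N. qpoch x x (N - 1) * qpoch x x N / (qpoch x x m * qpoch x x (2 * (N - 1 - m) + 1))
        * nested x (\<lambda>m. x ^ e m) p m)
      \<longlongrightarrow> (\<Sum>m<N. q powi (- int (2 * m\<^sup>2 + m)) * qpoch (q ^ (m + 1)) q m * nested q (\<lambda>m. q ^ e m) p m)) appr"
    by (intro tendsto_intros qpoch_ratio_tendsto) auto
  also have "(\<Sum>m<N. q powi (- int (2 * m\<^sup>2 + m)) * qpoch (q ^ (m + 1)) q m * nested q (\<lambda>m. q ^ e m) p m)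
     = q powi (- int p) *
    (\<Sum>m<N. q powi (- int (2 * m\<^sup>2 + m)) * qpoch (q ^ (m + 1)) q m * nested q (\<lambda>m. q ^ (m\<^sup>2)) p m)"
    by (simp add: nested sum_distrib_left mult_ac)
  finally show ?thesis
  proof (rule Lim_transform_eventually)
    show "\<forall>\<^sub>F x in appr. (\<Sum>m<N. qpoch x x (N - 1) * qpoch x x N / (qpoch x x m * qpoch x x (2 * (N - 1 - m) + 1))
        * nested x (\<lambda>m. x ^ e m) p m) = normalized_beta p x"
      using appr_generic
    proof eventually_elim
      case (elim x)
      interpret generic_base x by fact
      have "{..<N} = {..N-1}"
        using N by auto
      moreover have "bailey_beta x p (N - 1)
          = (\<Sum>m\<le>N-1. nested x (\<lambda>m. x ^ e m) p m / qpoch x x m * bailey_beta x 0 (N - 1 - m))"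
        using bailey_beta_reverse[of p 0 "N - 1"] by (simp add: e_def)
      ultimately show ?case
        by (simp add: normalized_beta_def sum_distrib_left mult_ac)
    qed
  qed
qed

text \<open>Summands with top index at least \<open>N\<close> vanish; the others are grouped by
  their top index.\<close>

lemma H9_eq_nested:
  "H9 (Suc p) q
    = (\<Sum>m<N. q powi (- int (2 * m\<^sup>2 + m)) * qpoch (q ^ (m + 1)) q m * nested q (\<lambda>m. q ^ (m\<^sup>2)) (Suc p) m)"
proof -
  define W where "W n = (\<Prod>i\<in>{1..<Suc p}. q ^ ((n i)\<^sup>2) * gbin q (n (i + 1)) (n i))" for n :: "nat \<Rightarrow> nat"
  define c where "c m = q powi (- int (m\<^sup>2) - int m) * qpoch (q ^ (m + 1)) q m" for m
  have c0: "c m = 0" if "N \<le> m" for m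
  proof -
    \<comment> \<open>Makes \<open>m+1+i\<close> the first multiple of \<open>N\<close> beyond
      \<open>m\<close>. As \<open>N <= m\<close>, this gives \<open>i < m\<close>, so
      \<open>(q^(m+1))_m\<close> has a zero factor.\<close>
    define i where "i = N - 1 - m mod N"
    have "m mod N < N"
      using N by simp
    then have "i < m"
      using that N by (simp add: i_def)
    have "m + 1 + i = N * (m div N + 1)"
    proof -
      have "m + 1 + i = N * (m div N) + (m mod N + 1 + i)"
        using mult_div_mod_eq[of N m] by linarith
      then show ?thesis
        using \<open>m mod N < N\<close> by (simp add: i_def)
    qed
    then have "q ^ (m + 1) * q ^ i = 1"
      by (simp only: power_add[symmetric] power_mult root_power_N power_one)
    then show ?thesis
      unfolding c_def by (simp only: qpoch_eq_0[OF \<open>i < m\<close>] mult_zero_right)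
  qed
  have "H9 (Suc p) q = (\<Sum>\<^sub>\<infinity>n\<in>mono_tuples (Suc p). c (n (Suc p)) * W n)"
    unfolding H9_def
  proof (rule infsum_cong)
    fix n assume "n \<in> mono_tuples (Suc p)"
    then have "(\<Prod>i\<in>{1..<Suc p}. q ^ ((n i)\<^sup>2) * eval_ratfun (qbinom qvar (n (i + 1)) (n i)) q) = W n"
      unfolding W_def by (intro prod.cong) (auto simp: mono_tuples_def eval_ratfun_qbinom)
    then show "q powi (- int ((n (Suc p))\<^sup>2) - int (n (Suc p))) * qpoch (q ^ (n (Suc p) + 1)) q (n (Suc p)) *
        (\<Prod>i\<in>{1..<Suc p}. q ^ ((n i)\<^sup>2) * eval_ratfun (qbinom qvar (n (i + 1)) (n i)) q)
      = c (n (Suc p)) * W n"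
      by (simp add: c_def)
  qed
  also have "\<dots> = (\<Sum>\<^sub>\<infinity>n\<in>(\<Union>m\<in>{..<N}. tuples_last (Suc p) m). c (n (Suc p)) * W n)"
    by (rule infsum_cong_neutral) (auto simp: tuples_last_def c0)
  also have "\<dots> = (\<Sum>n\<in>(\<Union>m\<in>{..<N}. tuples_last (Suc p) m). c (n (Suc p)) * W n)"
    by (rule infsum_finite) (simp add: finite_tuples_last)
  also have "\<dots> = (\<Sum>m<N. \<Sum>n\<in>tuples_last (Suc p) m. c (n (Suc p)) * W n)"
    by (rule sum.UNION_disjoint) (auto simp: finite_tuples_last, auto simp: tuples_last_def)
  also have "\<dots> = (\<Sum>m<N. c m * (\<Sum>n\<in>tuples_last (Suc p) m. W n))"
    by (simp add: sum_distrib_left tuples_last_def)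
  also have "\<dots> = (\<Sum>m<N. q powi (- int (2 * m\<^sup>2 + m)) * qpoch (q ^ (m + 1)) q m
      * nested q (\<lambda>m. q ^ (m\<^sup>2)) (Suc p) m)"
  proof (rule sum.cong)
    fix m
    \<comment> \<open>Splitting the exponent gives the top index the weight \<open>q^(m^2)\<close>
      of the lower ones, as \<open>nested\<close> requires.\<close>
    have e: "q powi (- int (m\<^sup>2) - int m) = q powi (- int (2 * m\<^sup>2 + m)) * q ^ (m\<^sup>2)"
    proof -
      have "- int (m\<^sup>2) - int m = - int (2 * m\<^sup>2 + m) + int (m\<^sup>2)"
        by simp
      then show ?thesis
        using root_nonzero by (metis power_int_add power_int_of_nat)
    qed
    show "c m * (\<Sum>n\<in>tuples_last (Suc p) m. W n)
      = q powi (- int (2 * m\<^sup>2 + m)) * qpoch (q ^ (m + 1)) q m * nested q (\<lambda>m. q ^ (m\<^sup>2)) (Suc p) m"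
      unfolding c_def e W_def sum_tuples_last[of "\<lambda>m. q ^ (m\<^sup>2)" m q p, symmetric]
      by (simp only: mult_ac)
  qed simp
  finally show ?thesis .
qed

text \<open>Both limits of \<open>normalized_beta\<close> coincide; multiplying by
  \<open>q^(p+1)\<close> clears the negative power.\<close>

lemma H9_eq_star:
  "H9 (Suc p) q
    = q ^ Suc p * (\<Sum>k=0..N-1. (-1) ^ k * q powi (- int ((k + 1) choose 2)) * star_coef q (Suc p) k)"
proof -
  have "q powi (- int (Suc p)) * H9 (Suc p) q
     = (\<Sum>k=0..N-1. (-1) ^ k * q powi (- int ((k + 1) choose 2)) * star_coef q (Suc p) k)"
    using tendsto_unique[OF appr_nontrivial normalized_beta_tendsto_nested normalized_beta_tendsto_star, of "Suc p"]
    by (simp only: H9_eq_nested)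
  then have "q ^ Suc p * (\<Sum>k=0..N-1. (-1) ^ k * q powi (- int ((k + 1) choose 2)) * star_coef q (Suc p) k)
     = q ^ Suc p * q powi (- int (Suc p)) * H9 (Suc p) q"
    by simp
  also have "q ^ Suc p * q powi (- int (Suc p)) = 1"
    unfolding power_int_minus power_int_of_nat using root_nonzero by (intro right_inverse) simp
  finally show ?thesis
    by simp
qed

end

theorem theorem2p14:
  fixes p N :: nat and q :: complex
  assumes "p \<ge> 1" and "N \<ge> 1" and "primitive_unity_root N q"
  shows "H9 p q =
    q ^ p * (\<Sum>k=0..N-1. (-1) ^ k * q powi (- int ((k + 1) choose 2)) *
      eval_ratfun (star qvar (\<lambda>j. qvar ^ (p * (j\<^sup>2 + 2 * j)) * alpha qvar j) k) q)"
proof -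
  obtain r where "p = Suc r"
    using assms(1) by (cases p) auto
  then show ?thesis
    using H9_eq_star[OF assms(2,3)] by (simp only: eval_ratfun_star)
qed

end
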